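(* Suppose $M$ is a structure of discrete (first-order) logic expanding a linear order, regarded as a metric structure with the $\{0,1\}$-valued discrete metric. If $f : M \to [0,1]$ is strongly regulated, then there is a continuous-logic definable predicate $\phi(x)$ (with parameters) with $\phi^M = f$. Conversely, if $M$ is o-minimal and $\phi(x)$ is a definable predicate (with $|x|=1$, with parameters), then $\phi^M$ is strongly regulated; and if $M$ is weakly o-minimal and $\phi(x)$ is such a definable predicate, then $\phi^M$ is weakly regulated.
   Context: For a linear order $X$, strong step functions are the $\mathbb{R}$-linear span of characteristic functions of intervals of $X$, and weak step functions are the $\mathbb{R}$-linear span of characteristic functions of order-convex subsets of $X$. A function $f:X\to\mathbb{R}$ is strongly regulated if it is a uniform limit of strong step functions, and weakly regulated if it is a uniform limit of weak step functions. In continuous logic, formulas take values in $[0,1]$ and definable predicates are uniform limits of formulas. A discrete structure expanding a dense... linear order is o-minimal if every definable subset of $M$ (with parameters) is a finite union of intervals and points, and weakly o-minimal if every such set is a finite union of order-convex sets. *)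

theory Defs
  imports "HOL-Analysis.Analysis"
begin

subsection \<open>Step functions and regulated functions on a linear order\<close>

text \<open>Intervals have endpoints in the order extended by \<open>\<plusminus>\<infinity>\<close>.\<close>

definition order_interval :: "'a::linorder set \<Rightarrow> bool" where
  "order_interval I \<longleftrightarrow>
     I = UNIV \<or>
     (\<exists>a. I = {a<..} \<or> I = {a..} \<or> I = {..<a} \<or> I = {..a}) \<or>
     (\<exists>a b. I = {a<..<b} \<or> I = {a..<b} \<or> I = {a<..b} \<or> I = {a..b})"

definition order_convex :: "'a::linorder set \<Rightarrow> bool" where
  "order_convex C \<longleftrightarrow> (\<forall>x\<in>C. \<forall>y\<in>C. \<forall>z. x \<le> z \<and> z \<le> y \<longrightarrow> z \<in> C)"

definition indicator_span :: "('a set \<Rightarrow> bool) \<Rightarrow> ('a \<Rightarrow> real) set" where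
  "indicator_span Q =
     {s. \<exists>\<F> c. finite \<F> \<and> (\<forall>S\<in>\<F>. Q S) \<and> s = (\<lambda>x. \<Sum>S\<in>\<F>. c S * indicator S x)}"

definition strong_step :: "('a::linorder \<Rightarrow> real) \<Rightarrow> bool" where
  "strong_step s \<longleftrightarrow> s \<in> indicator_span order_interval"

definition weak_step :: "('a::linorder \<Rightarrow> real) \<Rightarrow> bool" where
  "weak_step s \<longleftrightarrow> s \<in> indicator_span order_convex"

definition strongly_regulated :: "('a::linorder \<Rightarrow> real) \<Rightarrow> bool" where
  "strongly_regulated f \<longleftrightarrow>
     (\<exists>s. (\<forall>n. strong_step (s n)) \<and> uniform_limit UNIV s f sequentially)"

definition weakly_regulated :: "('a::linorder \<Rightarrow> real) \<Rightarrow> bool" where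
  "weakly_regulated f \<longleftrightarrow>
     (\<exists>s. (\<forall>n. weak_step (s n)) \<and> uniform_limit UNIV s f sequentially)"


subsection \<open>Languages and terms\<close>

text \<open>The symbols are explicit sets, so that a language may lack function symbols.
  Constant symbols are function symbols of arity 0.\<close>

record ('f, 'r) language =
  funs :: "'f set"
  rels :: "'r set"
  fun_arity :: "'f \<Rightarrow> nat"
  rel_arity :: "'r \<Rightarrow> nat"

text \<open>Terms over the language expanded by a constant \<open>Par a\<close> for every element \<open>a\<close>
  of the universe \<open>'a\<close>: these are the parameters.\<close>

datatype ('f, 'a) trm = Var nat | Par 'a | App 'f "('f, 'a) trm list"

fun wf_trm :: "('f, 'r) language \<Rightarrow> ('f, 'a) trm \<Rightarrow> bool" where
  "wf_trm L (Var x) \<longleftrightarrow> True"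
| "wf_trm L (Par a) \<longleftrightarrow> True"
| "wf_trm L (App f ts) \<longleftrightarrow>
     f \<in> funs L \<and> length ts = fun_arity L f \<and> (\<forall>t\<in>set ts. wf_trm L t)"

fun fv_trm :: "('f, 'a) trm \<Rightarrow> nat set" where
  "fv_trm (Var x) = {x}"
| "fv_trm (Par a) = {}"
| "fv_trm (App f ts) = (\<Union>t\<in>set ts. fv_trm t)"

fun trm_val :: "('f \<Rightarrow> 'a list \<Rightarrow> 'a) \<Rightarrow> (nat \<Rightarrow> 'a) \<Rightarrow> ('f, 'a) trm \<Rightarrow> 'a" where
  "trm_val F e (Var x) = e x"
| "trm_val F e (Par a) = a"
| "trm_val F e (App f ts) = F f (map (trm_val F e) ts)"


subsection \<open>Discrete first-order logic\<close>

record ('f, 'r, 'a) fo_struct =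
  fo_fun :: "'f \<Rightarrow> 'a list \<Rightarrow> 'a"
  fo_rel :: "'r \<Rightarrow> 'a list \<Rightarrow> bool"

datatype ('f, 'r, 'a) fo_formula =
    FEq "('f, 'a) trm" "('f, 'a) trm"
  | FRel 'r "('f, 'a) trm list"
  | FNeg "('f, 'r, 'a) fo_formula"
  | FAnd "('f, 'r, 'a) fo_formula" "('f, 'r, 'a) fo_formula"
  | FEx nat "('f, 'r, 'a) fo_formula"

primrec wf_fo :: "('f, 'r) language \<Rightarrow> ('f, 'r, 'a) fo_formula \<Rightarrow> bool" where
  "wf_fo L (FEq s t) \<longleftrightarrow> wf_trm L s \<and> wf_trm L t"
| "wf_fo L (FRel r ts) \<longleftrightarrow>
     r \<in> rels L \<and> length ts = rel_arity L r \<and> (\<forall>t\<in>set ts. wf_trm L t)"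
| "wf_fo L (FNeg \<phi>) \<longleftrightarrow> wf_fo L \<phi>"
| "wf_fo L (FAnd \<phi> \<psi>) \<longleftrightarrow> wf_fo L \<phi> \<and> wf_fo L \<psi>"
| "wf_fo L (FEx x \<phi>) \<longleftrightarrow> wf_fo L \<phi>"

primrec fv_fo :: "('f, 'r, 'a) fo_formula \<Rightarrow> nat set" where
  "fv_fo (FEq s t) = fv_trm s \<union> fv_trm t"
| "fv_fo (FRel r ts) = (\<Union>t\<in>set ts. fv_trm t)"
| "fv_fo (FNeg \<phi>) = fv_fo \<phi>"
| "fv_fo (FAnd \<phi> \<psi>) = fv_fo \<phi> \<union> fv_fo \<psi>"
| "fv_fo (FEx x \<phi>) = fv_fo \<phi> - {x}"

primrec fo_sat :: "('f, 'r, 'a) fo_struct \<Rightarrow> (nat \<Rightarrow> 'a) \<Rightarrow> ('f, 'r, 'a) fo_formula \<Rightarrow> bool" where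
  "fo_sat M e (FEq s t) \<longleftrightarrow> trm_val (fo_fun M) e s = trm_val (fo_fun M) e t"
| "fo_sat M e (FRel r ts) \<longleftrightarrow> fo_rel M r (map (trm_val (fo_fun M) e) ts)"
| "fo_sat M e (FNeg \<phi>) \<longleftrightarrow> \<not> fo_sat M e \<phi>"
| "fo_sat M e (FAnd \<phi> \<psi>) \<longleftrightarrow> fo_sat M e \<phi> \<and> fo_sat M e \<psi>"
| "fo_sat M e (FEx x \<phi>) \<longleftrightarrow> (\<exists>a. fo_sat M (e(x := a)) \<phi>)"

text \<open>Only \<open>Var 0\<close> may be free, so the constant assignment \<open>\<lambda>_. a\<close> just gives it the value \<open>a\<close>.\<close>

definition definable_set :: "('f, 'r) language \<Rightarrow> ('f, 'r, 'a) fo_struct \<Rightarrow> 'a set \<Rightarrow> bool" where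
  "definable_set L M D \<longleftrightarrow>
     (\<exists>\<phi>. wf_fo L \<phi> \<and> fv_fo \<phi> \<subseteq> {0} \<and> D = {a. fo_sat M (\<lambda>_. a) \<phi>})"

definition expands_linorder :: "('f, 'r) language \<Rightarrow> ('f, 'r, 'a::linorder) fo_struct \<Rightarrow> bool" where
  "expands_linorder L M \<longleftrightarrow>
     (\<exists>r\<in>rels L. rel_arity L r = 2 \<and> (\<forall>x y. fo_rel M r [x, y] \<longleftrightarrow> x < y))"

definition o_minimal :: "('f, 'r) language \<Rightarrow> ('f, 'r, 'a::linorder) fo_struct \<Rightarrow> bool" where
  "o_minimal L M \<longleftrightarrow>
     (\<forall>D. definable_set L M D \<longrightarrow>
        (\<exists>\<F>. finite \<F> \<and> (\<forall>S\<in>\<F>. order_interval S \<or> (\<exists>a. S = {a})) \<and> D = \<Union>\<F>))"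

definition weakly_o_minimal :: "('f, 'r) language \<Rightarrow> ('f, 'r, 'a::linorder) fo_struct \<Rightarrow> bool" where
  "weakly_o_minimal L M \<longleftrightarrow>
     (\<forall>D. definable_set L M D \<longrightarrow>
        (\<exists>\<F>. finite \<F> \<and> (\<forall>S\<in>\<F>. order_convex S) \<and> D = \<Union>\<F>))"


subsection \<open>Continuous logic\<close>

record ('f, 'r, 'a) metric_struct =
  ms_dist :: "'a \<Rightarrow> 'a \<Rightarrow> real"
  ms_fun :: "'f \<Rightarrow> 'a list \<Rightarrow> 'a"
  ms_rel :: "'r \<Rightarrow> 'a list \<Rightarrow> real"

definition metric_structure :: "('f, 'r) language \<Rightarrow> ('f, 'r, 'a) metric_struct \<Rightarrow> bool" where
  "metric_structure L N \<longleftrightarrow>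
     Metric_space UNIV (ms_dist N) \<and> Metric_space.mcomplete UNIV (ms_dist N) \<and>
     (\<forall>x y. ms_dist N x y \<le> 1) \<and>
     (\<forall>r\<in>rels L. \<forall>xs. length xs = rel_arity L r \<longrightarrow> ms_rel N r xs \<in> {0..1}) \<and>
     (\<forall>f\<in>funs L. \<forall>\<epsilon>>0. \<exists>\<delta>>0. \<forall>xs ys.
        length xs = fun_arity L f \<and> list_all2 (\<lambda>x y. ms_dist N x y < \<delta>) xs ys \<longrightarrow>
        ms_dist N (ms_fun N f xs) (ms_fun N f ys) \<le> \<epsilon>) \<and>
     (\<forall>r\<in>rels L. \<forall>\<epsilon>>0. \<exists>\<delta>>0. \<forall>xs ys.
        length xs = rel_arity L r \<and> list_all2 (\<lambda>x y. ms_dist N x y < \<delta>) xs ys \<longrightarrow>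
        \<bar>ms_rel N r xs - ms_rel N r ys\<bar> \<le> \<epsilon>)"

text \<open>In continuous logic the value 0 means true.\<close>

definition discrete_metric_struct :: "('f, 'r, 'a) fo_struct \<Rightarrow> ('f, 'r, 'a) metric_struct" where
  "discrete_metric_struct M =
     \<lparr>ms_dist = discrete_metric.dd, ms_fun = fo_fun M,
      ms_rel = (\<lambda>r xs. if fo_rel M r xs then 0 else 1)\<rparr>"

lemma metric_structure_discrete_metric_struct:
  fixes M :: "('f, 'r, 'a) fo_struct"
  shows "metric_structure L (discrete_metric_struct M)"
proof -
  have eq: "xs = ys" if "list_all2 (\<lambda>x y. discrete_metric.dd x y < 1) xs ys" for xs ys :: "'a list"
    using that by (simp add: discrete_metric.dd_def list_all2_conv_all_nth list_eq_iff_nth_eq)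
      (metis less_irrefl)
  have dd_refl: "discrete_metric.dd x x = 0" for x :: 'a
    by (simp add: discrete_metric.dd_def)
  show ?thesis
    unfolding metric_structure_def discrete_metric_struct_def
    by (auto simp: metric_M_dd discrete_metric.mcomplete_discrete_metric discrete_metric.dd_le1
        dd_refl dest!: eq intro!: exI[of _ 1])
qed

datatype ('f, 'r, 'a) cl_formula =
    CDist "('f, 'a) trm" "('f, 'a) trm"
  | CRel 'r "('f, 'a) trm list"
  | CConn "(nat \<Rightarrow> real) \<Rightarrow> real" "('f, 'r, 'a) cl_formula list"
  | CSup nat "('f, 'r, 'a) cl_formula"
  | CInf nat "('f, 'r, 'a) cl_formula"

text \<open>The \<open>n\<close>-ary connectives are the continuous functions \<open>[0,1]\<^sup>n \<rightarrow> [0,1]\<close>. Points of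
  \<open>[0,1]\<^sup>n\<close> are functions on \<open>{..<n}\<close>, extended by \<open>undefined\<close>.\<close>

definition connective :: "nat \<Rightarrow> ((nat \<Rightarrow> real) \<Rightarrow> real) \<Rightarrow> bool" where
  "connective n u \<longleftrightarrow>
     continuous_map (product_topology (\<lambda>_. top_of_set {0..1}) {..<n}) (top_of_set {0..1}) u"

definition tuple :: "real list \<Rightarrow> nat \<Rightarrow> real" where
  "tuple vs = (\<lambda>i\<in>{..<length vs}. vs ! i)"

fun wf_cl :: "('f, 'r) language \<Rightarrow> ('f, 'r, 'a) cl_formula \<Rightarrow> bool" where
  "wf_cl L (CDist s t) \<longleftrightarrow> wf_trm L s \<and> wf_trm L t"
| "wf_cl L (CRel r ts) \<longleftrightarrow>
     r \<in> rels L \<and> length ts = rel_arity L r \<and> (\<forall>t\<in>set ts. wf_trm L t)"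
| "wf_cl L (CConn u \<phi>s) \<longleftrightarrow> connective (length \<phi>s) u \<and> (\<forall>\<phi>\<in>set \<phi>s. wf_cl L \<phi>)"
| "wf_cl L (CSup x \<phi>) \<longleftrightarrow> wf_cl L \<phi>"
| "wf_cl L (CInf x \<phi>) \<longleftrightarrow> wf_cl L \<phi>"

fun fv_cl :: "('f, 'r, 'a) cl_formula \<Rightarrow> nat set" where
  "fv_cl (CDist s t) = fv_trm s \<union> fv_trm t"
| "fv_cl (CRel r ts) = (\<Union>t\<in>set ts. fv_trm t)"
| "fv_cl (CConn u \<phi>s) = (\<Union>\<phi>\<in>set \<phi>s. fv_cl \<phi>)"
| "fv_cl (CSup x \<phi>) = fv_cl \<phi> - {x}"
| "fv_cl (CInf x \<phi>) = fv_cl \<phi> - {x}"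

fun cl_val :: "('f, 'r, 'a) metric_struct \<Rightarrow> (nat \<Rightarrow> 'a) \<Rightarrow> ('f, 'r, 'a) cl_formula \<Rightarrow> real" where
  "cl_val N e (CDist s t) = ms_dist N (trm_val (ms_fun N) e s) (trm_val (ms_fun N) e t)"
| "cl_val N e (CRel r ts) = ms_rel N r (map (trm_val (ms_fun N) e) ts)"
| "cl_val N e (CConn u \<phi>s) = u (tuple (map (cl_val N e) \<phi>s))"
| "cl_val N e (CSup x \<phi>) = (SUP a. cl_val N (e(x := a)) \<phi>)"
| "cl_val N e (CInf x \<phi>) = (INF a. cl_val N (e(x := a)) \<phi>)"

text \<open>A definable predicate in one variable, with parameters, is represented by its
  interpretation. The parameters may vary along the sequence of formulas.\<close>

definition definable_predicate ::
    "('f, 'r) language \<Rightarrow> ('f, 'r, 'a) metric_struct \<Rightarrow> ('a \<Rightarrow> real) \<Rightarrow> bool" where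
  "definable_predicate L N P \<longleftrightarrow>
     (\<exists>\<phi>. (\<forall>k. wf_cl L (\<phi> k) \<and> fv_cl (\<phi> k) \<subseteq> {0}) \<and>
          uniform_limit UNIV (\<lambda>k a. cl_val N (\<lambda>_. a) (\<phi> k)) P sequentially)"

end

theory Submission
  imports Defs
begin

text \<open>A continuous-logic formula over a discrete structure takes only finitely many values,
  and each of its level sets is first-order definable. Hence a formula in one variable is a linear
  combination of indicators of definable sets, and (weak) o-minimality makes it a step function.
  Conversely, the indicator of an interval is the value of a formula, and a real linear combination
  of such indicators, truncated to \<open>[0,1]\<close>, is obtained by a single connective; truncation does
  not increase the distance to a function with values in \<open>[0,1]\<close>.\<close>

subsection \<open>Spans of indicator functions\<close>

lemma indicator_span_zero: "(\<lambda>x. 0) \<in> indicator_span Q"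
  unfolding indicator_span_def by (intro CollectI exI[of _ "{}"]) auto

lemma indicator_span_indicator: "Q S \<Longrightarrow> (\<lambda>x. c * indicator S x) \<in> indicator_span Q"
proof -
  assume "Q S"
  moreover have "(\<lambda>x. c * indicator S x) = (\<lambda>x. \<Sum>T\<in>{S}. c * indicator T x)"
    by (rule ext) (simp only: sum.insert finite.emptyI empty_iff sum.empty not_False_eq_True add_0_right)
  ultimately show ?thesis
    unfolding indicator_span_def by (intro CollectI exI[of _ "{S}"] exI[of _ "\<lambda>_. c"]) auto
qed

lemma indicator_span_add:
  assumes "f \<in> indicator_span Q" "g \<in> indicator_span Q"
  shows "(\<lambda>x. f x + g x) \<in> indicator_span Q"
proof -
  obtain F c where F: "finite F" "\<forall>S\<in>F. Q S" "f = (\<lambda>x. \<Sum>S\<in>F. c S * indicator S x)"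
    using assms(1) unfolding indicator_span_def by blast
  obtain G d where G: "finite G" "\<forall>S\<in>G. Q S" "g = (\<lambda>x. \<Sum>S\<in>G. d S * indicator S x)"
    using assms(2) unfolding indicator_span_def by blast
  define k where "k S = (if S \<in> F then c S else 0) + (if S \<in> G then d S else 0)" for S
  have "f x + g x = (\<Sum>S\<in>F \<union> G. k S * indicator S x)" for x
  proof -
    have "f x = (\<Sum>S\<in>F \<union> G. (if S \<in> F then c S else 0) * indicator S x)"
      unfolding F(3) using F(1) G(1) by (intro sum.mono_neutral_cong_left) auto
    moreover have "g x = (\<Sum>S\<in>F \<union> G. (if S \<in> G then d S else 0) * indicator S x)"
      unfolding G(3) using F(1) G(1) by (intro sum.mono_neutral_cong_left) auto
    ultimately show ?thesis
      by (simp add: k_def distrib_right sum.distrib)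
  qed
  then show ?thesis
    unfolding indicator_span_def using F G
    by (intro CollectI exI[of _ "F \<union> G"] exI[of _ k]) auto
qed

lemma indicator_span_sum:
  assumes "\<And>i. i \<in> I \<Longrightarrow> f i \<in> indicator_span Q"
  shows "(\<lambda>x. \<Sum>i\<in>I. f i x) \<in> indicator_span Q"
  using assms
  by (induction I rule: infinite_finite_induct)
    (auto intro: indicator_span_zero indicator_span_add)

lemma indicator_span_scale:
  assumes "f \<in> indicator_span Q"
  shows "(\<lambda>x. c * f x) \<in> indicator_span Q"
proof -
  obtain F d where F: "\<forall>S\<in>F. Q S" "f = (\<lambda>x. \<Sum>S\<in>F. d S * indicator S x)"
    using assms unfolding indicator_span_def by blast
  have "(\<lambda>x. \<Sum>S\<in>F. (c * d S) * indicator S x) \<in> indicator_span Q"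
    using F(1) by (intro indicator_span_sum indicator_span_indicator) auto
  then show ?thesis
    by (simp add: F(2) sum_distrib_left mult.assoc)
qed

text \<open>The product of two indicators is the indicator of the intersection, so closure of
  \<open>Q\<close> under intersections carries each term of the combination back into the
  span.\<close>

lemma indicator_span_mult_indicator:
  assumes Int: "\<And>A B. Q A \<Longrightarrow> Q B \<Longrightarrow> Q (A \<inter> B)"
    and "Q S" "f \<in> indicator_span Q"
  shows "(\<lambda>x. indicator S x * f x) \<in> indicator_span Q"
proof -
  obtain F d where F: "\<forall>T\<in>F. Q T" "f = (\<lambda>x. \<Sum>T\<in>F. d T * indicator T x)"
    using assms(3) unfolding indicator_span_def by blast
  have "(\<lambda>x. \<Sum>T\<in>F. d T * indicator (S \<inter> T) x) \<in> indicator_span Q"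
    using F(1) assms(2) by (intro indicator_span_sum indicator_span_indicator Int) auto
  then show ?thesis
    by (simp add: F(2) sum_distrib_left indicator_inter_arith mult_ac)
qed

text \<open>Induction with inclusion-exclusion for two sets: the indicator of
  \<open>S \<union> U\<close> is the sum of the two indicators minus their product. The members of
  \<open>F\<close> may overlap, as they may in the families given by (weak) o-minimality.\<close>

lemma indicator_span_Union:
  assumes Int: "\<And>A B. Q A \<Longrightarrow> Q B \<Longrightarrow> Q (A \<inter> B)"
    and "finite F" "\<And>S. S \<in> F \<Longrightarrow> Q S"
  shows "indicator (\<Union>F) \<in> indicator_span Q"
  using assms(2,3)
proof (induction F rule: finite_induct)
  case empty
  then show ?case
    using indicator_span_zero by (simp add: indicator_def[abs_def])
next
  case (insert S F)
  then have IH: "indicator (\<Union>F) \<in> indicator_span Q" and S: "Q S"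
    by auto
  have "(\<lambda>x. 1 * indicator S x + (indicator (\<Union>F) x + (-1) * (indicator S x * indicator (\<Union>F) x)))
      \<in> indicator_span Q"
    by (intro indicator_span_add indicator_span_indicator indicator_span_scale S IH
        indicator_span_mult_indicator[where Q = Q] Int)
  also have "(\<lambda>x. 1 * indicator S x + (indicator (\<Union>F) x + (-1) * (indicator S x * indicator (\<Union>F) x)))
      = (indicator (\<Union>(insert S F)) :: _ \<Rightarrow> real)"
    by (rule ext) (simp add: indicator_def)
  finally show ?case .
qed

section \<open>Intervals as intersections of rays\<close>

definition lower_bounded_ray :: "'a::linorder set \<Rightarrow> bool" where
  "lower_bounded_ray A \<longleftrightarrow> A = UNIV \<or> (\<exists>a. A = {a<..} \<or> A = {a..})"

definition upper_bounded_ray :: "'a::linorder set \<Rightarrow> bool" where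
  "upper_bounded_ray B \<longleftrightarrow> B = UNIV \<or> (\<exists>b. B = {..<b} \<or> B = {..b})"

text \<open>An interval is one lower constraint (none, strict or weak) together with one upper
  constraint; the nine combinations are exactly the nine shapes of
  \<open>order_interval\<close>.\<close>

lemma order_interval_iff_Int_rays:
  fixes I :: "'a::linorder set"
  shows "order_interval I \<longleftrightarrow>
    (\<exists>A B. lower_bounded_ray A \<and> upper_bounded_ray B \<and> I = A \<inter> B)"
  (is "_ \<longleftrightarrow> ?rays I")
proof
  have rays: "?rays (A \<inter> B)" if "lower_bounded_ray A" "upper_bounded_ray B" for A B
    using that by iprover
  have low: "lower_bounded_ray UNIV" "lower_bounded_ray {a<..}" "lower_bounded_ray {a..}" for a :: 'a
    unfolding lower_bounded_ray_def by iprover+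
  have upp: "upper_bounded_ray UNIV" "upper_bounded_ray {..<b}" "upper_bounded_ray {..b}" for b :: 'a
    unfolding upper_bounded_ray_def by iprover+
  have r1: "?rays UNIV" "?rays {a<..}" "?rays {a..}" "?rays {..<a}" "?rays {..a}" for a
    using rays[OF low(1) upp(1)] rays[OF low(2) upp(1), of a] rays[OF low(3) upp(1), of a]
      rays[OF low(1) upp(2), of a] rays[OF low(1) upp(3), of a]
    unfolding Int_UNIV_left Int_UNIV_right by iprover+
  have r2: "?rays {a<..<b}" "?rays {a..<b}" "?rays {a<..b}" "?rays {a..b}" for a b
    unfolding greaterThanLessThan_def greaterThanAtMost_def atLeastLessThan_def atLeastAtMost_def
    by (rule rays low upp)+
  assume "order_interval I"
  then show "?rays I"
    unfolding order_interval_def by (elim disjE exE) (simp_all only: r1 r2)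
next
  have "order_interval UNIV" "order_interval {a<..}" "order_interval {a..}"
      "order_interval {..<a}" "order_interval {..a}" "order_interval ({a<..} \<inter> {..<b})"
      "order_interval ({a<..} \<inter> {..b})" "order_interval ({a..} \<inter> {..<b})"
      "order_interval ({a..} \<inter> {..b})" for a b :: 'a
    unfolding order_interval_def greaterThanLessThan_def greaterThanAtMost_def
      atLeastLessThan_def atLeastAtMost_def
    by iprover+
  moreover assume "?rays I"
  ultimately show "order_interval I"
    unfolding lower_bounded_ray_def upper_bounded_ray_def
    by (elim disjE exE conjE) (simp_all only: Int_UNIV_left Int_UNIV_right)
qed

text \<open>These rays are upward closed, and two upward closed sets of a linear order are nested;
  the intersection is therefore one of the two rays.\<close>

lemma lower_bounded_ray_Int:
  assumes "lower_bounded_ray A" "lower_bounded_ray B"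
  shows "lower_bounded_ray (A \<inter> B)"
proof -
  have "y \<in> C" if "lower_bounded_ray C" "x \<in> C" "x \<le> y" for x y :: 'a and C
    using that unfolding lower_bounded_ray_def by auto
  then have "A \<subseteq> B \<or> B \<subseteq> A"
    using assms by (meson linear subsetI)
  then show ?thesis
    using assms by (metis inf.absorb1 inf.absorb2)
qed

lemma upper_bounded_ray_Int:
  assumes "upper_bounded_ray A" "upper_bounded_ray B"
  shows "upper_bounded_ray (A \<inter> B)"
proof -
  have "y \<in> C" if "upper_bounded_ray C" "x \<in> C" "y \<le> x" for x y :: 'a and C
    using that unfolding upper_bounded_ray_def by auto
  then have "A \<subseteq> B \<or> B \<subseteq> A"
    using assms by (meson linear subsetI)
  then show ?thesis
    using assms by (metis inf.absorb1 inf.absorb2)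
qed

lemma order_interval_Int:
  assumes "order_interval I" "order_interval J"
  shows "order_interval (I \<inter> J)"
proof -
  obtain A B where I: "lower_bounded_ray A" "upper_bounded_ray B" "I = A \<inter> B"
    using assms(1) unfolding order_interval_iff_Int_rays by blast
  obtain A' B' where J: "lower_bounded_ray A'" "upper_bounded_ray B'" "J = A' \<inter> B'"
    using assms(2) unfolding order_interval_iff_Int_rays by blast
  \<comment> \<open>Lower constraints are grouped with lower ones and upper with upper, which avoids
    comparing the shapes of the two intervals.\<close>
  have "I \<inter> J = (A \<inter> A') \<inter> (B \<inter> B')"
    using I(3) J(3) by (simp add: Int_ac)
  then show ?thesis
    unfolding order_interval_iff_Int_rays
    using lower_bounded_ray_Int[OF I(1) J(1)] upper_bounded_ray_Int[OF I(2) J(2)] by iprover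
qed

text \<open>This absorbs the points in the definition of \<open>o_minimal\<close> into the
  intervals.\<close>

lemma order_interval_singleton: "order_interval {a}"
proof -
  have "order_interval {a..a}"
    unfolding order_interval_def by iprover
  then show ?thesis
    by simp
qed

lemma order_convex_Int: "order_convex A \<Longrightarrow> order_convex B \<Longrightarrow> order_convex (A \<inter> B)"
  unfolding order_convex_def by blast

subsection \<open>Definable sets of assignments\<close>

text \<open>Sets of whole assignments take the place of sets of tuples, and \<open>X\<close> bounds
  the free variables. A quantifier over \<open>x\<close> then merely removes \<open>x\<close> from
  \<open>X\<close>.\<close>

definition fo_definable ::
    "('f, 'r) language \<Rightarrow> ('f, 'r, 'a) fo_struct \<Rightarrow> nat set \<Rightarrow> (nat \<Rightarrow> 'a) set \<Rightarrow> bool" where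
  "fo_definable L M X A \<longleftrightarrow>
     (\<exists>\<psi>. wf_fo L \<psi> \<and> fv_fo \<psi> \<subseteq> X \<and> (\<forall>e. e \<in> A \<longleftrightarrow> fo_sat M e \<psi>))"

lemma fo_definable_mono: "fo_definable L M X A \<Longrightarrow> X \<subseteq> Y \<Longrightarrow> fo_definable L M Y A"
  unfolding fo_definable_def by blast

lemma fo_definable_Compl:
  assumes "fo_definable L M X A"
  shows "fo_definable L M X (- A)"
proof -
  obtain \<psi> where "wf_fo L \<psi>" "fv_fo \<psi> \<subseteq> X" "\<forall>e. e \<in> A \<longleftrightarrow> fo_sat M e \<psi>"
    using assms unfolding fo_definable_def by blast
  then show ?thesis
    unfolding fo_definable_def by (intro exI[of _ "FNeg \<psi>"]) auto
qed

lemma fo_definable_Int: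
  assumes "fo_definable L M X A" "fo_definable L M X B"
  shows "fo_definable L M X (A \<inter> B)"
proof -
  obtain \<psi> where "wf_fo L \<psi>" "fv_fo \<psi> \<subseteq> X" "\<forall>e. e \<in> A \<longleftrightarrow> fo_sat M e \<psi>"
    using assms(1) unfolding fo_definable_def by blast
  moreover obtain \<theta> where "wf_fo L \<theta>" "fv_fo \<theta> \<subseteq> X" "\<forall>e. e \<in> B \<longleftrightarrow> fo_sat M e \<theta>"
    using assms(2) unfolding fo_definable_def by blast
  ultimately show ?thesis
    unfolding fo_definable_def by (intro exI[of _ "FAnd \<psi> \<theta>"]) auto
qed

lemma fo_definable_UNIV: "fo_definable L M X UNIV"
  unfolding fo_definable_def
  \<comment> \<open>The set \<open>X\<close> may be empty, so the true equation is put under a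
    quantifier to make it a sentence.\<close>
  by (intro exI[of _ "FEx 0 (FEq (Var 0) (Var 0))"]) auto

lemma fo_definable_INT:
  assumes "finite I" "\<And>i. i \<in> I \<Longrightarrow> fo_definable L M X (A i)"
  shows "fo_definable L M X (\<Inter>i\<in>I. A i)"
  using assms
  by (induction I rule: finite_induct) (auto intro: fo_definable_UNIV fo_definable_Int)

lemma fo_definable_UN:
  assumes "finite I" "\<And>i. i \<in> I \<Longrightarrow> fo_definable L M X (A i)"
  shows "fo_definable L M X (\<Union>i\<in>I. A i)"
proof -
  have "fo_definable L M X (- (\<Inter>i\<in>I. - A i))"
    using assms by (intro fo_definable_Compl fo_definable_INT) auto
  then show ?thesis
    by simp
qed

lemma fo_definable_Ex:
  assumes "fo_definable L M X A"
  shows "fo_definable L M (X - {x}) {e. \<exists>a. e(x := a) \<in> A}"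
proof -
  obtain \<psi> where "wf_fo L \<psi>" "fv_fo \<psi> \<subseteq> X" "\<forall>e. e \<in> A \<longleftrightarrow> fo_sat M e \<psi>"
    using assms unfolding fo_definable_def by blast
  then show ?thesis
    unfolding fo_definable_def by (intro exI[of _ "FEx x \<psi>"]) auto
qed

section \<open>Functions of assignments with finite range and definable fibres\<close>

text \<open>This is the invariant of the induction on continuous-logic formulas. The value type is
  arbitrary, so that truth values, pairs, lists and sets of values fall under the same
  notion.\<close>

definition finitely_definable ::
    "('f, 'r) language \<Rightarrow> ('f, 'r, 'a) fo_struct \<Rightarrow> nat set \<Rightarrow> ((nat \<Rightarrow> 'a) \<Rightarrow> 'b) \<Rightarrow> bool" where
  "finitely_definable L M X g \<longleftrightarrow> finite (range g) \<and> (\<forall>v. fo_definable L M X (g -` {v}))"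

lemma finitely_definable_mono:
  "finitely_definable L M X g \<Longrightarrow> X \<subseteq> Y \<Longrightarrow> finitely_definable L M Y g"
  unfolding finitely_definable_def using fo_definable_mono by blast

lemma finitely_definable_const: "finitely_definable L M X (\<lambda>e. c)"
proof -
  have "fo_definable L M X ((\<lambda>e. c) -` {v})" for v
    using fo_definable_UNIV[of L M X] fo_definable_Compl[OF fo_definable_UNIV, of L M X]
    by (cases "c = v") (auto simp: vimage_def)
  then show ?thesis
    by (simp add: finitely_definable_def)
qed

text \<open>A fibre of the composite over \<open>v\<close> is the union of the fibres of
  \<open>g\<close> over those of its finitely many values that \<open>h\<close> sends to
  \<open>v\<close>.\<close>

lemma finitely_definable_compose:
  assumes "finitely_definable L M X g"
  shows "finitely_definable L M X (\<lambda>e. h (g e))"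
proof -
  have "range (\<lambda>e. h (g e)) = h ` range g"
    by auto
  then have "finite (range (\<lambda>e. h (g e)))"
    using assms by (simp add: finitely_definable_def)
  moreover have "fo_definable L M X ((\<lambda>e. h (g e)) -` {v})" for v
  proof -
    have "(\<lambda>e. h (g e)) -` {v} = (\<Union>w\<in>{w \<in> range g. h w = v}. g -` {w})"
      by auto
    then show ?thesis
      using assms by (simp only: finitely_definable_def) (intro fo_definable_UN, auto)
  qed
  ultimately show ?thesis
    by (simp add: finitely_definable_def)
qed

lemma finitely_definable_Pair:
  assumes "finitely_definable L M X g" "finitely_definable L M X h"
  shows "finitely_definable L M X (\<lambda>e. (g e, h e))"
proof -
  have "finite (range (\<lambda>e. (g e, h e)))"
    using assms unfolding finitely_definable_def
    by (intro finite_subset[of "range (\<lambda>e. (g e, h e))" "range g \<times> range h"]) auto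
  moreover have "(\<lambda>e. (g e, h e)) -` {v} = g -` {fst v} \<inter> h -` {snd v}" for v
    by auto
  ultimately show ?thesis
    using assms by (simp add: finitely_definable_def fo_definable_Int)
qed

text \<open>Prepares connectives of any arity: the list of argument values is built up by pairing
  and then applying the list constructor.\<close>

lemma finitely_definable_map:
  assumes "\<And>g. g \<in> set gs \<Longrightarrow> finitely_definable L M X (f g)"
  shows "finitely_definable L M X (\<lambda>e. map (\<lambda>g. f g e) gs)"
  using assms
proof (induction gs)
  case Nil
  then show ?case
    by (simp add: finitely_definable_const)
next
  case (Cons g gs)
  then have "finitely_definable L M X (\<lambda>e. (f g e, map (\<lambda>g. f g e) gs))"
    by (intro finitely_definable_Pair) auto
  from finitely_definable_compose[OF this, of "\<lambda>(v, vs). v # vs"] show ?case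
    by simp
qed

text \<open>Supremum and infimum over \<open>x\<close> both depend only on the set of values that
  \<open>g\<close> takes as \<open>x\<close> varies. This set is one of the finitely many subsets of
  \<open>range g\<close>, and which one it is can be expressed in first-order logic. The cases
  \<open>h = Sup\<close> and \<open>h = Inf\<close> give the two quantifiers.\<close>

lemma finitely_definable_quantifier:
  assumes "finitely_definable L M X g"
  shows "finitely_definable L M (X - {x}) (\<lambda>e. h (range (\<lambda>a. g (e(x := a)))))"
proof -
  let ?s = "\<lambda>e. range (\<lambda>a. g (e(x := a)))"
  have fin: "finite (range g)"
    using assms by (simp add: finitely_definable_def)
  have "finite (range ?s)"
    by (rule finite_subset[of _ "Pow (range g)"]) (use fin in auto)
  moreover have "fo_definable L M (X - {x}) (?s -` {V})" for V
  proof (cases "V \<subseteq> range g")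
    case True
    let ?E = "\<lambda>v. {e. \<exists>a. e(x := a) \<in> g -` {v}}"
    have "e \<in> ?s -` {V} \<longleftrightarrow> e \<in> (\<Inter>v\<in>V. ?E v) \<inter> (\<Inter>v\<in>range g - V. - ?E v)" for e
    proof -
      \<comment> \<open>The value set equals \<open>V\<close> iff every value in \<open>V\<close> is
        attained and no other value of \<open>g\<close> is; each attainment is an existential
        statement, and only finitely many occur.\<close>
      have "?s e = V \<longleftrightarrow> (\<forall>v\<in>V. v \<in> ?s e) \<and> (\<forall>v\<in>range g - V. v \<notin> ?s e)"
        using True by blast
      moreover have "v \<in> ?s e \<longleftrightarrow> e \<in> ?E v" for v
        by auto
      ultimately show ?thesis
        by simp
    qed
    then have "?s -` {V} = (\<Inter>v\<in>V. ?E v) \<inter> (\<Inter>v\<in>range g - V. - ?E v)"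
      by (rule set_eqI)
    moreover have E: "fo_definable L M (X - {x}) (?E v)" for v
      using assms by (intro fo_definable_Ex) (simp add: finitely_definable_def)
    have "finite V"
      using True fin by (rule finite_subset)
    then have "fo_definable L M (X - {x}) ((\<Inter>v\<in>V. ?E v) \<inter> (\<Inter>v\<in>range g - V. - ?E v))"
      using fin E by (intro fo_definable_Int fo_definable_INT fo_definable_Compl finite_Diff)
    ultimately show ?thesis
      by (simp only:)
  next
    case False
    \<comment> \<open>A set containing something outside \<open>range g\<close> is never the value
      set, so this fibre is empty.\<close>
    then have "?s -` {V} = - UNIV"
      by auto
    then show ?thesis
      by (simp only: fo_definable_Compl[OF fo_definable_UNIV])
  qed
  ultimately have "finitely_definable L M (X - {x}) ?s"
    by (simp add: finitely_definable_def)
  then show ?thesis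
    by (rule finitely_definable_compose)
qed

text \<open>Covers the atomic formulas: the truth value of \<open>\<psi>\<close> has a definable set
  and its complement as fibres, and the two outcomes are a function of it.\<close>

lemma finitely_definable_if:
  assumes "wf_fo L \<psi>" "fv_fo \<psi> \<subseteq> X"
  shows "finitely_definable L M X (\<lambda>e. if fo_sat M e \<psi> then v else w)"
proof -
  have def: "fo_definable L M X {e. fo_sat M e \<psi>}"
    unfolding fo_definable_def using assms by auto
  have "(\<lambda>e. fo_sat M e \<psi>) -` {b} = (if b then {e. fo_sat M e \<psi>} else - {e. fo_sat M e \<psi>})" for b
    by auto
  then have "finitely_definable L M X (\<lambda>e. fo_sat M e \<psi>)"
    using def fo_definable_Compl[OF def] by (simp add: finitely_definable_def)
  then show ?thesis
    by (rule finitely_definable_compose)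
qed

section \<open>Values of continuous-logic formulas over a discrete structure\<close>

text \<open>Induction on the formula. Atoms take only the values 0 (true) and 1 (false), a
  connective is a function of the list of its argument values, and a quantifier is a function of a
  set of values.\<close>

lemma finitely_definable_cl_val:
  fixes M :: "('f, 'r, 'a) fo_struct" and \<phi> :: "('f, 'r, 'a) cl_formula"
  assumes "wf_cl L \<phi>"
  shows "finitely_definable L M (fv_cl \<phi>) (\<lambda>e. cl_val (discrete_metric_struct M) e \<phi>)"
  using assms
proof (induction \<phi>)
  case (CDist s t)
  then show ?case
    using finitely_definable_if[of L "FEq s t" "fv_cl (CDist s t)" M 0 1]
    by (simp add: discrete_metric_struct_def discrete_metric.dd_def)
next
  case (CRel r ts)
  then show ?case
    using finitely_definable_if[of L "FRel r ts" "fv_cl (CRel r ts)" M 0 1]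
    by (simp add: discrete_metric_struct_def)
next
  case (CConn u \<phi>s)
  have "finitely_definable L M (fv_cl (CConn u \<phi>s))
      (\<lambda>e. map (\<lambda>\<phi>. cl_val (discrete_metric_struct M) e \<phi>) \<phi>s)"
    using CConn by (intro finitely_definable_map) (force intro: finitely_definable_mono)
  then show ?case
    using finitely_definable_compose[of L M _ _ "\<lambda>vs. u (tuple vs)"] by simp
next
  case (CSup x \<phi>)
  then show ?case
    using finitely_definable_quantifier[of L M "fv_cl \<phi>" _ x Sup] by simp
next
  case (CInf x \<phi>)
  then show ?case
    using finitely_definable_quantifier[of L M "fv_cl \<phi>" _ x Inf] by simp
qed

lemma sum_level_indicators:
  fixes g :: "'a \<Rightarrow> real"
  assumes "finite V" "g a \<in> V"
  shows "(\<Sum>v\<in>V. v * indicator {a. g a = v} a) = g a"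
proof -
  have "(\<Sum>v\<in>V. v * indicator {a. g a = v} a) = (\<Sum>v\<in>V. if v = g a then v else 0)"
    by (intro sum.cong refl) (simp add: indicator_def)
  then show ?thesis
    using assms by simp
qed

text \<open>Stated for a general \<open>Q\<close> so that \<open>order_interval\<close> and
  \<open>order_convex\<close> give the two minimality statements at once. The formula is expanded as
  the sum of its values times the indicators of its level sets, each of which is definable and hence
  a finite union of \<open>Q\<close>-sets.\<close>

lemma cl_val_in_indicator_span:
  fixes M :: "('f, 'r, 'a) fo_struct"
  assumes Int: "\<And>A B. Q A \<Longrightarrow> Q B \<Longrightarrow> Q (A \<inter> B)"
    and min: "\<And>D. definable_set L M D \<Longrightarrow> \<exists>F. finite F \<and> (\<forall>S\<in>F. Q S) \<and> D = \<Union>F"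
    and \<phi>: "wf_cl L \<phi>" "fv_cl \<phi> \<subseteq> {0}"
  shows "(\<lambda>a. cl_val (discrete_metric_struct M) (\<lambda>_. a) \<phi>) \<in> indicator_span Q"
proof -
  let ?g = "\<lambda>e. cl_val (discrete_metric_struct M) e \<phi>"
  have g: "finitely_definable L M {0} ?g"
    using finitely_definable_cl_val[OF \<phi>(1)] \<phi>(2) by (rule finitely_definable_mono)
  then have fin: "finite (range ?g)"
    by (simp add: finitely_definable_def)
  have level: "indicator {a. ?g (\<lambda>_. a) = v} \<in> indicator_span Q" for v
  proof -
    have "fo_definable L M {0} (?g -` {v})"
      using g by (simp add: finitely_definable_def)
    then obtain \<psi> where \<psi>: "wf_fo L \<psi>" "fv_fo \<psi> \<subseteq> {0}"
        "\<And>e. e \<in> ?g -` {v} \<longleftrightarrow> fo_sat M e \<psi>"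
      unfolding fo_definable_def by blast
    have "definable_set L M {a. ?g (\<lambda>_. a) = v}"
      unfolding definable_set_def
      by (intro exI[of _ \<psi>] conjI \<psi>(1,2)) (simp add: \<psi>(3)[symmetric])
    from min[OF this] obtain F where F: "finite F" "\<forall>S\<in>F. Q S" "{a. ?g (\<lambda>_. a) = v} = \<Union>F"
      by (elim exE conjE)
    have "indicator (\<Union>F) \<in> indicator_span Q"
      using Int F(1) F(2)[rule_format] by (rule indicator_span_Union)
    then show ?thesis
      by (simp only: F(3))
  qed
  \<comment> \<open>The index set is the range over all assignments: it is finite and contains every
    value at a constant assignment.\<close>
  have "(\<lambda>a. \<Sum>v\<in>range ?g. v * indicator {a. ?g (\<lambda>_. a) = v} a) \<in> indicator_span Q"
    by (rule indicator_span_sum, rule indicator_span_scale, rule level)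
  moreover have "(\<Sum>v\<in>range ?g. v * indicator {a. ?g (\<lambda>_. a) = v} a) = ?g (\<lambda>_. a)" for a
    using fin by (rule sum_level_indicators[where g = "\<lambda>a. ?g (\<lambda>_. a)"]) (rule rangeI)
  ultimately show ?thesis
    by (simp only:)
qed

subsection \<open>Truncated affine combinations as connectives\<close>

definition truncate :: "real \<Rightarrow> real" where
  "truncate t = max 0 (min 1 t)"

lemma truncate_eq: "0 \<le> t \<Longrightarrow> t \<le> 1 \<Longrightarrow> truncate t = t"
  by (simp add: truncate_def)

lemma truncate_nonexpansive: "\<bar>truncate s - truncate t\<bar> \<le> \<bar>s - t\<bar>"
  by (auto simp: truncate_def max_def min_def)

text \<open>An affine combination of coordinates is continuous but may leave the unit interval;
  truncation brings it back.\<close>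

lemma connective_truncate_affine:
  "connective n (\<lambda>x. truncate (d + (\<Sum>i<n. c i * x i)))"
proof -
  let ?T = "product_topology (\<lambda>_. top_of_set {0..1::real}) {..<n}"
  have "continuous_map ?T euclideanreal (\<lambda>x. x i)" if "i < n" for i
    using that continuous_map_into_fulltopology[OF continuous_map_product_projection[of i "{..<n}"]]
    by auto
  then have "continuous_map ?T euclideanreal (\<lambda>x. d + (\<Sum>i<n. c i * x i))"
    by (intro continuous_map_add continuous_map_sum continuous_map_real_mult) auto
  moreover have "continuous_map euclideanreal (top_of_set {0..1}) truncate"
    unfolding truncate_def
    by (auto simp: continuous_map_in_subtopology intro!: continuous_intros)
  ultimately show ?thesis
    unfolding connective_def by (rule continuous_map_compose[unfolded o_def])
qed

section \<open>Functions that are the exact value of a single formula\<close>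

definition cl_definable ::
    "('f, 'r) language \<Rightarrow> ('f, 'r, 'a) metric_struct \<Rightarrow> ('a \<Rightarrow> real) \<Rightarrow> bool" where
  "cl_definable L N g \<longleftrightarrow>
     (\<exists>\<phi>. wf_cl L \<phi> \<and> fv_cl \<phi> \<subseteq> {0} \<and> (\<forall>a. cl_val N (\<lambda>_. a) \<phi> = g a))"

text \<open>The formulas for the \<open>h i\<close> become the arguments of one connective.
  Connectives take lists, so \<open>I\<close> is enumerated by a list without repetitions, which
  counts every summand once.\<close>

lemma cl_definable_truncate_affine:
  assumes "finite I" "\<And>i. i \<in> I \<Longrightarrow> cl_definable L N (h i)"
  shows "cl_definable L N (\<lambda>a. truncate (d + (\<Sum>i\<in>I. c i * h i a)))"
proof -
  obtain \<phi> where \<phi>: "\<And>i. i \<in> I \<Longrightarrow>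
      wf_cl L (\<phi> i) \<and> fv_cl (\<phi> i) \<subseteq> {0} \<and> (\<forall>a. cl_val N (\<lambda>_. a) (\<phi> i) = h i a)"
    using assms(2) unfolding cl_definable_def by metis
  obtain js where js: "set js = I" "distinct js"
    using finite_distinct_list[OF assms(1)] by blast
  let ?u = "\<lambda>x. truncate (d + (\<Sum>j<length js. c (js ! j) * x j))"
  let ?\<psi> = "CConn ?u (map \<phi> js)"
  have "cl_val N (\<lambda>_. a) ?\<psi> = truncate (d + (\<Sum>i\<in>I. c i * h i a))" for a
  proof -
    have "(\<Sum>j<length js. c (js ! j) * tuple (map (cl_val N (\<lambda>_. a)) (map \<phi> js)) j)
        = (\<Sum>j<length js. c (js ! j) * h (js ! j) a)"
      using \<phi> js(1) by (intro sum.cong) (auto simp: tuple_def)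
    also have "\<dots> = (\<Sum>i\<in>I. c i * h i a)"
      using sum.reindex_bij_betw[OF bij_betw_nth[OF js(2) refl js(1)[symmetric]]] .
    finally show ?thesis
      by simp
  qed
  moreover have "wf_cl L ?\<psi>" "fv_cl ?\<psi> \<subseteq> {0}"
    using \<phi> js(1) connective_truncate_affine[of "length js" d "\<lambda>j. c (js ! j)"] by auto
  ultimately show ?thesis
    unfolding cl_definable_def by blast
qed

lemma cl_definable_indicator_Compl:
  assumes "cl_definable L N (indicator A)"
  shows "cl_definable L N (indicator (- A))"
proof -
  \<comment> \<open>The complement has indicator \<open>1 - indicator A\<close>; the one-element
    index set supplies the single summand.\<close>
  have "cl_definable L N (\<lambda>a. truncate (1 + (\<Sum>i\<in>{0::nat}. (-1) * indicator A a)))"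
    using assms by (intro cl_definable_truncate_affine) auto
  also have "(\<lambda>a. truncate (1 + (\<Sum>i\<in>{0::nat}. (-1) * indicator A a))) = indicator (- A)"
    by (rule ext) (auto simp: truncate_def indicator_def)
  finally show ?thesis .
qed

text \<open>On the values 0 and 1 the Lukasiewicz conjunction \<open>max 0 (s + t - 1)\<close> is
  ordinary conjunction, and it is a truncated affine combination.\<close>

lemma cl_definable_indicator_Int:
  assumes "cl_definable L N (indicator A)" "cl_definable L N (indicator B)"
  shows "cl_definable L N (indicator (A \<inter> B))"
proof -
  \<comment> \<open>Indexing by truth values keeps the two summands apart even when
    \<open>A = B\<close>.\<close>
  have "cl_definable L N
      (\<lambda>a. truncate (-1 + (\<Sum>i\<in>{False, True}. 1 * (if i then indicator A else indicator B) a)))"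
    using assms by (intro cl_definable_truncate_affine) auto
  also have "(\<lambda>a. truncate (-1 + (\<Sum>i\<in>{False, True}. 1 * (if i then indicator A else indicator B) a)))
      = indicator (A \<inter> B)"
    by (rule ext) (auto simp: truncate_def indicator_def)
  finally show ?thesis .
qed

lemma cl_definable_indicator_interval:
  fixes M :: "('f, 'r, 'a::linorder) fo_struct"
  assumes "expands_linorder L M" "order_interval I"
  shows "cl_definable L (discrete_metric_struct M) (indicator I)"
proof -
  let ?N = "discrete_metric_struct M"
  let ?D = "\<lambda>A. cl_definable L ?N (indicator A)"
  obtain r where r: "r \<in> rels L" "rel_arity L r = 2" "\<And>x y. fo_rel M r [x, y] \<longleftrightarrow> x < y"
    using assms(1) unfolding expands_linorder_def by blast
  \<comment> \<open>Since 0 means true, the atomic formula saying \<open>a < x\<close> has the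
    indicator of the complement of the ray as its value.\<close>
  have "cl_definable L ?N (indicator (- {a<..}))" for a
    unfolding cl_definable_def using r
    by (intro exI[of _ "CRel r [Par a, Var 0]"])
      (auto simp: discrete_metric_struct_def indicator_def)
  from cl_definable_indicator_Compl[OF this] have gt: "?D {a<..}" for a
    by simp
  have ge: "cl_definable L ?N (indicator (- {..<a}))" for a
    unfolding cl_definable_def using r
    by (intro exI[of _ "CRel r [Var 0, Par a]"])
      (auto simp: discrete_metric_struct_def indicator_def)
  from cl_definable_indicator_Compl[OF this] have lt: "?D {..<a}" for a
    by simp
  have le: "?D {..a}" for a
    using cl_definable_indicator_Compl[OF gt[of a]] by (simp add: Compl_greaterThan)
  \<comment> \<open>The constant 1 is the empty affine combination with
    \<open>d = 1\<close>.\<close>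
  have UNIV: "?D UNIV"
    using cl_definable_truncate_affine[of "{} :: nat set" L ?N _ 1]
    by (simp add: truncate_def indicator_def[abs_def])
  obtain A B where "lower_bounded_ray A" "upper_bounded_ray B" "I = A \<inter> B"
    using assms(2) unfolding order_interval_iff_Int_rays by blast
  then show ?thesis
    using UNIV gt ge lt le unfolding lower_bounded_ray_def upper_bounded_ray_def
    by (auto simp: Compl_lessThan intro!: cl_definable_indicator_Int)
qed

section \<open>Regulated functions and definable predicates\<close>

lemma definable_predicate_if_strongly_regulated:
  fixes M :: "('f, 'r, 'a::linorder) fo_struct"
  assumes "expands_linorder L M" "range f \<subseteq> {0..1}" "strongly_regulated f"
  shows "definable_predicate L (discrete_metric_struct M) f"
proof -
  let ?N = "discrete_metric_struct M"
  obtain s where s: "\<And>n. strong_step (s n)" "uniform_limit UNIV s f sequentially"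
    using assms(3) unfolding strongly_regulated_def by blast
  have "cl_definable L ?N (\<lambda>a. truncate (s n a))" for n
  proof -
    obtain F c where "finite F" "\<forall>S\<in>F. order_interval S"
        "s n = (\<lambda>x. \<Sum>S\<in>F. c S * indicator S x)"
      using s(1)[of n] unfolding strong_step_def indicator_span_def by blast
    then show ?thesis
      using cl_definable_truncate_affine[of F L ?N indicator 0 c]
        cl_definable_indicator_interval[OF assms(1)] by simp
  qed
  then obtain \<phi> where \<phi>: "\<And>n. wf_cl L (\<phi> n) \<and> fv_cl (\<phi> n) \<subseteq> {0}"
      "\<And>n a. cl_val ?N (\<lambda>_. a) (\<phi> n) = truncate (s n a)"
    unfolding cl_definable_def by metis
  have f: "truncate (f a) = f a" for a
    using assms(2) by (intro truncate_eq) (auto simp: image_subset_iff)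
  \<comment> \<open>Since \<open>f\<close> is fixed by truncation, truncating the approximant
    amounts to truncating both arguments of the distance.\<close>
  have "dist (truncate (s n a)) (f a) \<le> dist (s n a) (f a)" for n a
    using truncate_nonexpansive[of "s n a" "f a"] by (simp add: f dist_real_def)
  then have le: "\<forall>a\<in>UNIV. dist (truncate (s n a)) (f a) < \<epsilon>"
    if "\<forall>a\<in>UNIV. dist (s n a) (f a) < \<epsilon>" for n \<epsilon>
    using that by (blast intro: le_less_trans)
  have "uniform_limit UNIV (\<lambda>n a. truncate (s n a)) f sequentially"
    unfolding uniform_limit_iff
  proof (intro allI impI)
    fix \<epsilon> :: real
    assume "\<epsilon> > 0"
    then have "\<forall>\<^sub>F n in sequentially. \<forall>a\<in>UNIV. dist (s n a) (f a) < \<epsilon>"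
      using s(2) unfolding uniform_limit_iff by blast
    then show "\<forall>\<^sub>F n in sequentially. \<forall>a\<in>UNIV. dist (truncate (s n a)) (f a) < \<epsilon>"
      by (rule eventually_mono) (rule le)
  qed
  then show ?thesis
    unfolding definable_predicate_def using \<phi> by (intro exI[of _ \<phi>]) simp
qed

theorem theorem6p6:
  fixes L :: "('f, 'r) language" and M :: "('f, 'r, 'a::linorder) fo_struct"
  assumes "expands_linorder L M"
  shows "(\<forall>f. range f \<subseteq> {0..1} \<and> strongly_regulated f \<longrightarrow>
            definable_predicate L (discrete_metric_struct M) f) \<and>
         (o_minimal L M \<longrightarrow>
            (\<forall>P. definable_predicate L (discrete_metric_struct M) P \<longrightarrow> strongly_regulated P)) \<and>
         (weakly_o_minimal L M \<longrightarrow>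
            (\<forall>P. definable_predicate L (discrete_metric_struct M) P \<longrightarrow> weakly_regulated P))"
proof (intro conjI allI impI)
  fix f :: "'a \<Rightarrow> real"
  assume "range f \<subseteq> {0..1} \<and> strongly_regulated f"
  then show "definable_predicate L (discrete_metric_struct M) f"
    using definable_predicate_if_strongly_regulated[OF assms] by blast
next
  fix P :: "'a \<Rightarrow> real"
  assume "o_minimal L M" and P: "definable_predicate L (discrete_metric_struct M) P"
  then have min: "\<exists>F. finite F \<and> (\<forall>S\<in>F. order_interval S) \<and> D = \<Union>F" if "definable_set L M D" for D
    using that order_interval_singleton unfolding o_minimal_def by metis
  obtain \<phi> where "\<And>k. wf_cl L (\<phi> k)" "\<And>k. fv_cl (\<phi> k) \<subseteq> {0}"
      and lim: "uniform_limit UNIV (\<lambda>k a. cl_val (discrete_metric_struct M) (\<lambda>_. a) (\<phi> k)) P sequentially"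
    using P unfolding definable_predicate_def by blast
  \<comment> \<open>The values of each approximating formula already form a step function, so the
    sequence witnessing definability also witnesses regularity.\<close>
  then have "strong_step (\<lambda>a. cl_val (discrete_metric_struct M) (\<lambda>_. a) (\<phi> k))" for k
    unfolding strong_step_def
    by (intro cl_val_in_indicator_span[where Q = order_interval] order_interval_Int min)
  with lim show "strongly_regulated P"
    unfolding strongly_regulated_def by (intro exI conjI allI)
next
  fix P :: "'a \<Rightarrow> real"
  assume "weakly_o_minimal L M" and P: "definable_predicate L (discrete_metric_struct M) P"
  then have min: "\<exists>F. finite F \<and> (\<forall>S\<in>F. order_convex S) \<and> D = \<Union>F" if "definable_set L M D" for D
    using that unfolding weakly_o_minimal_def by blast
  obtain \<phi> where "\<And>k. wf_cl L (\<phi> k)" "\<And>k. fv_cl (\<phi> k) \<subseteq> {0}"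
      and lim: "uniform_limit UNIV (\<lambda>k a. cl_val (discrete_metric_struct M) (\<lambda>_. a) (\<phi> k)) P sequentially"
    using P unfolding definable_predicate_def by blast
  then have "weak_step (\<lambda>a. cl_val (discrete_metric_struct M) (\<lambda>_. a) (\<phi> k))" for k
    unfolding weak_step_def
    by (intro cl_val_in_indicator_span[where Q = order_convex] order_convex_Int min)
  with lim show "weakly_regulated P"
    unfolding weakly_regulated_def by (intro exI conjI allI)
qed

end
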